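(* Let $D\subset\mathbb{R}^2$ be bounded, let $\mathcal{G}:=\{(x,\mu)\in\mathbb{R}^3 : \mu=x_1x_2,\ x\in D\}$, and let $\mathcal{H}\subset\mathbb{R}^2$ be an axis-aligned region with $D\subseteq\mathcal{H}$ (an axis-aligned outer-approximation of $D$). Define $$\mathcal{R}:=\operatorname{conv}\bigl\{(x,x_1x_2) : x\in\mathcal{H}\bigr\}.$$ Then $\mathcal{R}$ is a polyhedral relaxation of $\mathcal{G}$ (that is, $\mathcal{R}$ is a polyhedron with $\mathcal{G}\subseteq\mathcal{R}$), and $\mathcal{R}=\operatorname{conv}(\mathcal{Q})$, where $$\mathcal{Q}:=\bigl\{(x,\mu) : \mu=x_1x_2,\ x\in\operatorname{corner}(\mathcal{H})\bigr\}.$$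
   Context: A planar region $\mathcal{H}\subset\mathbb{R}^2$ is axis-aligned if it is a finite union of (closed, bounded) rectangles with sides parallel to the coordinate axes. A point $v=(v_1,v_2)$ is a corner point of $\mathcal{H}$ if for each $i\in\{1,2\}$, with $i'$ the other index, $v_i$ is an extreme point of $\operatorname{conv}\{x_i : x\in\mathcal{H},\ x_{i'}=v_{i'}\}$. The set of corner points is denoted $\operatorname{corner}(\mathcal{H})$. *)

theory Defs
  imports "HOL-Analysis.Analysis"
begin

(* Rectangles are library boxes cbox a b = {x. a$1 <= x$1 <= b$1, a$2 <= x$2 <= b$2};
   degenerate and empty ones are allowed, and so is the empty union. *)
definition axis_aligned :: "(real^2) set \<Rightarrow> bool" where
  "axis_aligned H \<longleftrightarrow>
     (\<exists>\<F>. finite \<F> \<and> (\<forall>B\<in>\<F>. \<exists>a b. B = cbox a b) \<and> H = \<Union>\<F>)"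

(* The index type 2 has exactly the elements 1 and 2, so i' is the index other than i.
   For closed H the condition already forces v \<in> H. *)
definition corner :: "(real^2) set \<Rightarrow> (real^2) set" where
  "corner H = {v. \<forall>i i'. i' \<noteq> i \<longrightarrow>
     (v $ i) extreme_point_of (convex hull {x $ i |x. x \<in> H \<and> x $ i' = v $ i'})}"

(* (x, \<mu>) \<in> R^3 is represented in the Euclidean space (real^2) \<times> real. *)
definition bilinear_graph :: "(real^2) set \<Rightarrow> ((real^2) \<times> real) set" where
  "bilinear_graph S = {(x, \<mu>). \<mu> = x $ 1 * x $ 2 \<and> x \<in> S}"

definition polyhedral_relaxation :: "'a::euclidean_space set \<Rightarrow> 'a set \<Rightarrow> bool" where
  "polyhedral_relaxation R G \<longleftrightarrow> polyhedron R \<and> G \<subseteq> R"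

end

theory Submission
  imports Defs
begin

text \<open>
  The region \<open>H\<close> is compact, hence so are the graph of the bilinear map over \<open>H\<close> and the convex
  hull \<open>R\<close> of that graph.  By Minkowski's theorem \<open>R\<close> is the convex hull of its extreme points,
  all of which lie on the graph.  Along a line parallel to a coordinate axis the map
  \<open>x \<mapsto> x\<^sub>1 x\<^sub>2\<close> is affine, so the convex hull of an axis-parallel slice of \<open>H\<close> lifts affinely and
  injectively into \<open>R\<close>; therefore a graph point over \<open>x\<close> can be extreme in \<open>R\<close> only if each \<open>x\<^sub>i\<close>
  is extreme in the convex hull of its slice, i.e. if \<open>x\<close> is a corner point
  (\<open>corner_if_extreme_point\<close>).  This gives \<open>R\<close> as the convex hull of the graph over the corner
  points.  A corner point that lies in one of the boxes forming \<open>H\<close> must be a vertex of that box,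
  so there are finitely many of them (\<open>finite_corner\<close>) and \<open>R\<close> is a polytope.
\<close>

lemma prod_coords_2:
  fixes x :: "real^2" and i i' :: 2
  assumes "i' \<noteq> i"
  shows "x $ 1 * x $ 2 = x $ i * x $ i'"
  using assms exhaust_2[of i] exhaust_2[of i'] by auto

lemma bilinear_graph_eq_image: "bilinear_graph S = (\<lambda>x. (x, x $ 1 * x $ 2)) ` S"
  by (auto simp: bilinear_graph_def)

lemma compact_axis_aligned:
  assumes "axis_aligned H"
  shows "compact H"
  using assms unfolding axis_aligned_def by (auto intro!: compact_Union)

lemma compact_bilinear_graph:
  assumes "compact S"
  shows "compact (bilinear_graph S)"
  unfolding bilinear_graph_eq_image
  by (intro compact_continuous_image assms continuous_intros)

lemma corner_subset: "corner H \<subseteq> H"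
proof
  fix v assume "v \<in> corner H"
  then have "(v $ 1) extreme_point_of (convex hull {x $ 1 |x. x \<in> H \<and> x $ 2 = v $ 2})"
    by (simp add: corner_def)
  then have "v $ 1 \<in> {x $ 1 |x. x \<in> H \<and> x $ 2 = v $ 2}"
    by (rule extreme_point_of_convex_hull)
  then obtain x where "x \<in> H" "x $ 1 = v $ 1" "x $ 2 = v $ 2"
    by auto
  moreover from this have "x = v"
    by (simp add: vec_eq_iff forall_2)
  ultimately show "v \<in> H"
    by simp
qed

lemma corner_in_box_is_vertex:
  fixes v a b :: "real^2"
  assumes v: "v \<in> corner H" and sub: "cbox a b \<subseteq> H" and vb: "v \<in> cbox a b"
  shows "v $ i = a $ i \<or> v $ i = b $ i"
proof (rule ccontr)
  assume neg: "\<not> ?thesis"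
  obtain i' :: 2 where i': "i' \<noteq> i"
    using that[of 1] that[of 2] by (cases "i = 1") auto
  let ?S = "{x $ i |x. x \<in> H \<and> x $ i' = v $ i'}"
  have box: "a $ j \<le> v $ j" "v $ j \<le> b $ j" for j
    using vb by (auto simp: mem_box_cart)
  have slice: "t \<in> convex hull ?S" if "a $ i \<le> t" "t \<le> b $ i" for t
  proof -
    let ?y = "\<chi> j. if j = i then t else v $ j"
    have "?y \<in> cbox a b"
      using that box by (auto simp: mem_box_cart)
    then have "?y \<in> H \<and> ?y $ i' = v $ i'"
      using sub i' by auto
    then have "?y $ i \<in> ?S"
      by blast
    then show ?thesis
      by (simp add: hull_inc)
  qed
  have lt: "a $ i < v $ i" "v $ i < b $ i"
    using neg box[of i] by auto
  have "(v $ i) extreme_point_of (convex hull ?S)"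
    using v i' by (simp add: corner_def)
  moreover have "a $ i \<in> convex hull ?S" "b $ i \<in> convex hull ?S"
    using slice lt by auto
  ultimately have "v $ i \<notin> open_segment (a $ i) (b $ i)"
    by (auto simp: extreme_point_of_def)
  then show False
    using lt by (simp add: open_segment_eq_real_ivl)
qed

lemma finite_corner:
  assumes "axis_aligned H"
  shows "finite (corner H)"
proof -
  obtain \<F> where fin: "finite \<F>" and boxes: "\<forall>B\<in>\<F>. \<exists>a b. B = cbox a b" and H: "H = \<Union>\<F>"
    using assms unfolding axis_aligned_def by blast
  have "finite (corner H \<inter> B)" if B_in: "B \<in> \<F>" for B
  proof -
    obtain a b where B: "B = cbox a b"
      using bspec[OF boxes B_in] by (elim exE)
    let ?V = "{v :: real^2. \<forall>i. v $ i \<in> {a $ i, b $ i}}"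
    have "cbox a b \<subseteq> H"
      using B_in unfolding H B by (rule Union_upper)
    then have "corner H \<inter> B \<subseteq> ?V"
      using corner_in_box_is_vertex[of _ H a b] by (auto simp: B)
    moreover have "finite ?V"
    proof (rule finite_subset)
      show "?V \<subseteq> vec_lambda ` (\<Pi>\<^sub>E i\<in>UNIV. {a $ i, b $ i})"
      proof
        fix v assume "v \<in> ?V"
        then have "vec_nth v \<in> (\<Pi>\<^sub>E i\<in>UNIV. {a $ i, b $ i})"
          by (simp add: PiE_UNIV_domain)
        then show "v \<in> vec_lambda ` (\<Pi>\<^sub>E i\<in>UNIV. {a $ i, b $ i})"
          by (intro image_eqI[of _ _ "vec_nth v"]) simp_all
      qed
      show "finite (vec_lambda ` (\<Pi>\<^sub>E i\<in>UNIV. {a $ i, b $ i}))"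
        by (intro finite_imageI finite_PiE) simp_all
    qed
    ultimately show ?thesis
      by (rule finite_subset)
  qed
  then have "finite (\<Union>B\<in>\<F>. corner H \<inter> B)"
    using fin by blast
  moreover have "corner H \<subseteq> (\<Union>B\<in>\<F>. corner H \<inter> B)"
    using corner_subset[of H] by (auto simp: H)
  ultimately show ?thesis
    by (rule rev_finite_subset)
qed

lemma corner_if_extreme_point:
  assumes x: "x \<in> H"
    and ext: "(x, x $ 1 * x $ 2) extreme_point_of (convex hull (bilinear_graph H))"
  shows "x \<in> corner H"
  unfolding corner_def
proof (intro CollectI allI impI)
  fix i i' :: 2 assume i': "i' \<noteq> i"
  let ?R = "convex hull (bilinear_graph H)"
  let ?S = "{y $ i |y. y \<in> H \<and> y $ i' = x $ i'}"
  \<comment> \<open>the lift of the line through \<open>x\<close> in direction \<open>i\<close>; it is affine as \<open>x\<^sub>i\<^sub>'\<close> is fixed\<close>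
  define f where "f t = ((\<chi> j. if j = i then t else x $ j), t * x $ i')" for t :: real
  have affine: "f (u * s + w * t) = u *\<^sub>R f s + w *\<^sub>R f t" if "u + w = 1" for u w s t
  proof -
    have "x $ j = u * x $ j + w * x $ j" for j
      using that by (metis distrib_right mult_1)
    then show ?thesis
      unfolding f_def by (simp add: vec_eq_iff distrib_right)
  qed
  have inj: "f s = f t \<Longrightarrow> s = t" for s t
    by (auto simp: f_def vec_eq_iff split: if_splits)
  have lift: "f (y $ i) = (y, y $ 1 * y $ 2)" if "y $ i' = x $ i'" for y
  proof -
    have "x $ j = y $ j" if "j \<noteq> i" for j
    proof -
      have "j = i'"
        using that i' exhaust_2[of i] exhaust_2[of i'] exhaust_2[of j] by auto
      then show ?thesis
        using \<open>y $ i' = x $ i'\<close> by simp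
    qed
    then have "(\<chi> j. if j = i then y $ i else x $ j) = y"
      by (simp add: vec_eq_iff)
    then show ?thesis
      using that by (simp add: f_def prod_coords_2[OF i'])
  qed
  have "convex hull ?S \<subseteq> {t. f t \<in> ?R}"
  proof (rule hull_minimal)
    show "?S \<subseteq> {t. f t \<in> ?R}"
      by (auto simp: lift bilinear_graph_def intro!: hull_inc)
    show "convex {t. f t \<in> ?R}"
    proof (rule convexI)
      fix s t u w :: real
      assume st: "s \<in> {t. f t \<in> ?R}" "t \<in> {t. f t \<in> ?R}" and uw: "0 \<le> u" "0 \<le> w" "u + w = 1"
      have "u *\<^sub>R f s + w *\<^sub>R f t \<in> ?R"
        using st uw by (intro convexD[OF convex_convex_hull]) simp_all
      then show "u *\<^sub>R s + w *\<^sub>R t \<in> {t. f t \<in> ?R}"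
        using affine[OF uw(3), of s t] by simp
    qed
  qed
  then have in_R: "f t \<in> ?R" if "t \<in> convex hull ?S" for t
    using that by blast
  show "(x $ i) extreme_point_of (convex hull ?S)"
    unfolding extreme_point_of_def
  proof (intro conjI ballI notI)
    show "x $ i \<in> convex hull ?S"
      using x by (auto intro: hull_inc)
  next
    fix a b assume a: "a \<in> convex hull ?S" and b: "b \<in> convex hull ?S"
      and "x $ i \<in> open_segment a b"
    then obtain u where "a \<noteq> b" and u: "0 < u" "u < 1" and "x $ i = (1 - u) * a + u * b"
      by (auto simp: in_segment)
    then have "f (x $ i) = (1 - u) *\<^sub>R f a + u *\<^sub>R f b"
      by (simp add: affine)
    then have "f (x $ i) \<in> open_segment (f a) (f b)"
      using u \<open>a \<noteq> b\<close> inj by (auto simp: in_segment)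
    then show False
      using ext in_R[OF a] in_R[OF b] by (simp add: lift extreme_point_of_def)
  qed
qed

lemma convex_hull_graph_eq_corner:
  assumes "compact H"
  shows "convex hull (bilinear_graph H) = convex hull (bilinear_graph (corner H))"
    (is "?R = ?Q")
proof
  have "{p. p extreme_point_of ?R} \<subseteq> bilinear_graph (corner H)"
  proof
    fix p assume "p \<in> {p. p extreme_point_of ?R}"
    then have ext: "p extreme_point_of ?R"
      by simp
    then have "p \<in> bilinear_graph H"
      by (rule extreme_point_of_convex_hull)
    then obtain x where "x \<in> H" "p = (x, x $ 1 * x $ 2)"
      by (auto simp: bilinear_graph_def)
    then show "p \<in> bilinear_graph (corner H)"
      using ext corner_if_extreme_point by (simp add: bilinear_graph_def)
  qed
  moreover have "?R = convex hull {p. p extreme_point_of ?R}"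
    using assms
    by (intro Krein_Milman_Minkowski compact_convex_hull compact_bilinear_graph convex_convex_hull)
  ultimately show "?R \<subseteq> ?Q"
    by (metis hull_mono)
  show "?Q \<subseteq> ?R"
    using corner_subset[of H] by (intro hull_mono) (auto simp: bilinear_graph_def)
qed

theorem proposition4:
  fixes D H :: "(real^2) set"
  assumes "bounded D"
    and "axis_aligned H"
    and "D \<subseteq> H"
  shows "polyhedral_relaxation (convex hull {(x, x $ 1 * x $ 2) |x. x \<in> H}) (bilinear_graph D)
    \<and> convex hull {(x, x $ 1 * x $ 2) |x. x \<in> H} = convex hull (bilinear_graph (corner H))"
proof -
  have graph: "{(x, x $ 1 * x $ 2) |x. x \<in> H} = bilinear_graph H"
    by (auto simp: bilinear_graph_def)
  have eq: "convex hull (bilinear_graph H) = convex hull (bilinear_graph (corner H))"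
    using assms(2) by (intro convex_hull_graph_eq_corner compact_axis_aligned)
  have "finite (bilinear_graph (corner H))"
    unfolding bilinear_graph_eq_image using finite_corner[OF assms(2)] by (rule finite_imageI)
  then have "polyhedron (convex hull (bilinear_graph H))"
    unfolding eq by (intro polytope_imp_polyhedron polytope_convex_hull)
  moreover have "bilinear_graph D \<subseteq> convex hull (bilinear_graph H)"
    using assms(3) by (auto simp: bilinear_graph_def intro!: hull_inc)
  ultimately show ?thesis
    using eq by (simp add: graph polyhedral_relaxation_def)
qed

end
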